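(* For every integer $n\ge 0$, $$ H_n\!\left( \tfrac32 \right) = \prod_{i=1}^n \frac{(2i-1)!\, (6i)!\, (3i+1)}{2\, (4i-1)!\, (4i+1)!}. $$
   Context: For $k\ge 0$ let $a_k(x)=\sum_{m=0}^{k}\binom{3k+1-m}{k-m}x^m$, and for $n\ge 0$ let $H_n(x)=\det[a_{i+j}(x)]_{0\le i,j\le n}$ be the $(n+1)\times(n+1)$ Hankel determinant. Empty products equal $1$. *)

theory Defs
  imports Complex_Main "Jordan_Normal_Form.Determinant"
begin

(* The natural-number subtractions never truncate, since m \<le> k throughout the sum. *)
definition a_poly :: "nat \<Rightarrow> 'a::comm_ring_1 \<Rightarrow> 'a" where
  "a_poly k x = (\<Sum>m=0..k. of_nat ((3 * k + 1 - m) choose (k - m)) * x ^ m)"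

(* Size n + 1: the rows and columns of mat are indexed from 0. *)
definition hankel_det :: "nat \<Rightarrow> 'a::comm_ring_1 \<Rightarrow> 'a" where
  "hankel_det n x = det (mat (n + 1) (n + 1) (\<lambda>(i, j). a_poly (i + j) x))"

end

theory Submission
  imports Defs "HOL-Computational_Algebra.Formal_Power_Series"
begin

text \<open>
  The idea is that the series \<open>A(z) = \<Sum>k. a\<^sub>k(3/2) z\<^sup>k\<close> is a quotient of two hypergeometric
  series, so that the numerators of its continued fraction remainders are known explicitly.

  Let \<open>T = 1 + z T\<^sup>3\<close> be the generating function of ternary trees and \<open>S = 1/T\<close>. Summing the
  binomial series gives \<open>((1 - x) + x S) A\<^sub>x = T\<^sup>2 / (3 - 2 T) = \<Sum>k. (3k+1 choose k) z\<^sup>k\<close>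
  (\<open>a_fps_1_eq\<close>). At \<open>x = 3/2\<close> the factor \<open>D = (3 S - 1)/2\<close> on the left is the hypergeometric series
  \<open>F(-1/3, 1/3; 1/2; 27z/4)\<close>, and the right-hand side is \<open>F(2/3, 4/3; 3/2; 27z/4)\<close>. In terms of the
  angle \<open>w\<close> with \<open>sin\<^sup>2(w/2) = 27z/4\<close> these are \<open>cos(w/3)\<close> and \<open>3 sin(w/3) / sin w\<close>; the continued
  fraction below is thus a form of Euler's continued fraction of \<open>tan(s arctan t)\<close>.

  Put \<open>f\<^sub>n = h\<^sub>n z\<^sup>n F(n + 2/3, n + 4/3; 2n + 3/2; 27z/4)\<close>. With suitable scalars \<open>h\<^sub>n\<close>, \<open>h\<^sub>0 = 1\<close>,
  these series satisfy the contiguous relations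
  \<open>z f\<^sub>1 = (1 - \<beta>\<^sub>0 z) f\<^sub>0 - D\<close> and \<open>z f\<^sub>n\<^sub>+\<^sub>1 = (1 - \<beta>\<^sub>n z) f\<^sub>n - \<lambda>\<^sub>n z f\<^sub>n\<^sub>-\<^sub>1\<close>
  (\<open>remainder_1\<close>, \<open>remainder_rec\<close>). Divided by \<open>D\<close>, they say that \<open>R\<^sub>n = f\<^sub>n / D\<close> are the remainders of
  the Jacobi continued fraction of \<open>R\<^sub>0 = A\<close>. As \<open>R\<^sub>n\<close> begins with \<open>h\<^sub>n z\<^sup>n\<close>, the monic polynomials
  generated by the same recurrence are orthogonal with squared norms \<open>h\<^sub>n\<close>, and the Hankel determinant
  is \<open>h\<^sub>0 \<dots> h\<^sub>n\<close> (\<open>det_hankel_three_term\<close>). The factors in the theorem are the \<open>h\<^sub>i\<close>.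
\<close>

(* The dollar sign denotes coefficients of power series here, not entries of vectors. *)
no_notation vec_index (infixl "$" 100)
unbundle fps_syntax

section \<open>Hankel determinants and three-term recurrences\<close>

text \<open>
  Here \<open>p k j\<close> is the coefficient of \<open>X\<^sup>j\<close> in a monic polynomial \<open>p\<^sub>k\<close> of degree \<open>k\<close>, and the assumption
  \<open>orth\<close> says that \<open>p\<^sub>k\<close> is orthogonal to all lower powers of \<open>X\<close> for the functional with moments
  \<open>a\<close>. Multiplying the Hankel matrix by the unitriangular coefficient matrix makes it upper
  triangular.
\<close>
lemma det_hankel_if_orthogonal:
  fixes a :: "nat \<Rightarrow> 'a :: comm_ring_1" and p :: "nat \<Rightarrow> nat \<Rightarrow> 'a"
  assumes monic: "\<And>k. p k k = 1"
    and degree: "\<And>k j. k < j \<Longrightarrow> p k j = 0"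
    and orth: "\<And>k i. i < k \<Longrightarrow> (\<Sum>j\<le>k. p k j * a (i + j)) = 0"
  shows "det (mat (Suc n) (Suc n) (\<lambda>(i, j). a (i + j))) =
    (\<Prod>k\<le>n. \<Sum>j\<le>k. p k j * a (k + j))"
proof -
  define M where "M = mat (Suc n) (Suc n) (\<lambda>(i, j). a (i + j))"
  define P where "P = mat (Suc n) (Suc n) (\<lambda>(i, j). p i j)"
  have M: "M \<in> carrier_mat (Suc n) (Suc n)" and P: "P \<in> carrier_mat (Suc n) (Suc n)"
    by (simp_all add: M_def P_def)
  have PM: "(P * M) $$ (k, i) = (\<Sum>j\<le>k. p k j * a (i + j))" if "k \<le> n" "i \<le> n" for k i
  proof -
    have "(P * M) $$ (k, i) = (\<Sum>j<Suc n. p k j * a (i + j))"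
      using that by (simp add: P_def M_def scalar_prod_def add.commute lessThan_atLeast0)
    also have "\<dots> = (\<Sum>j\<le>k. p k j * a (i + j))"
      using that degree by (intro sum.mono_neutral_right) auto
    finally show ?thesis .
  qed
  have "det P = prod_list (diag_mat P)"
    by (rule det_lower_triangular[OF _ P]) (simp add: P_def degree)
  also have "diag_mat P = map (\<lambda>_. 1) [0..<Suc n]"
    unfolding diag_mat_def by (rule map_cong) (auto simp: P_def monic)
  also have "prod_list \<dots> = 1"
    by (simp add: prod.distinct_set_conv_list [symmetric])
  finally have detP: "det P = 1" .
  have PMc: "P * M \<in> carrier_mat (Suc n) (Suc n)"
    using P M by simp
  have "det (P * M) = prod_list (diag_mat (P * M))"
  proof (rule det_upper_triangular[OF _ PMc])
    show "upper_triangular (P * M)"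
    proof (rule upper_triangularI)
      fix i j assume "j < i" "i < dim_row (P * M)"
      then show "(P * M) $$ (i, j) = 0"
        using P by (subst PM) (auto intro: orth)
    qed
  qed
  also have "diag_mat (P * M) = map (\<lambda>k. \<Sum>j\<le>k. p k j * a (k + j)) [0..<Suc n]"
    unfolding diag_mat_def using P by (intro map_cong) (auto simp: PM simp del: index_mult_mat(1))
  also have "prod_list \<dots> = (\<Prod>k\<le>n. \<Sum>j\<le>k. p k j * a (k + j))"
    by (subst prod.distinct_set_conv_list [symmetric])
      (simp_all add: atMost_atLeast0 atLeastLessThanSuc_atLeastAtMost del: upt_Suc)
  finally show ?thesis
    using det_mult[OF P M] detP by (simp add: M_def)
qed

text \<open>
  The series \<open>R n\<close> are the remainders of the Jacobi continued fraction of \<open>R 0\<close>. The recurrence shows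
  that \<open>R n $ i\<close> is the moment of \<open>X\<^sup>i p\<^sub>n\<close> for a monic polynomial \<open>p\<^sub>n\<close> of degree \<open>n\<close>, where the
  coefficients of \<open>R 0\<close> are the moments; vanishing of \<open>R n\<close> to order \<open>n\<close> is then orthogonality.
\<close>
lemma det_hankel_three_term:
  fixes R :: "nat \<Rightarrow> 'a :: comm_ring_1 fps" and b l :: "nat \<Rightarrow> 'a"
  assumes R1: "fps_X * R 1 = (1 - fps_const (b 0) * fps_X) * R 0 - 1"
    and R2: "\<And>n. fps_X * R (n + 2) =
      (1 - fps_const (b (n + 1)) * fps_X) * R (n + 1) - fps_const (l (n + 1)) * fps_X * R n"
    and subdegree: "\<And>n i. i < n \<Longrightarrow> R n $ i = 0"
  shows "det (mat (Suc n) (Suc n) (\<lambda>(i, j). R 0 $ (i + j))) = (\<Prod>k\<le>n. R k $ k)"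
proof -
  have R1': "R 1 $ i = R 0 $ Suc i - b 0 * R 0 $ i" for i
    using arg_cong[OF R1, of "\<lambda>f. f $ Suc i"] by (simp add: algebra_simps)
  have R2': "R (n + 2) $ i = R (n + 1) $ Suc i - b (n + 1) * R (n + 1) $ i - l (n + 1) * R n $ i"
    for n i
    using arg_cong[OF R2[of n], of "\<lambda>f. f $ Suc i"] by (simp add: algebra_simps)
  have shift: "(\<Sum>j\<le>Suc N. (case j of 0 \<Rightarrow> 0 | Suc j' \<Rightarrow> q j') * R 0 $ (i + j)) =
      (\<Sum>j\<le>N. q j * R 0 $ (Suc i + j))" for q N i
    by (subst sum.atMost_Suc_shift) simp
  have ext: "(\<Sum>j\<le>N. q j * R 0 $ (i + j)) = (\<Sum>j\<le>k. q j * R 0 $ (i + j))"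
    if "\<And>j. k < j \<Longrightarrow> q j = 0" "k \<le> N" for q k N i
    using that by (intro sum.mono_neutral_right) auto
  \<comment> \<open>\<open>q\<close> lists the coefficients of the monic polynomial belonging to \<open>R k\<close>.\<close>
  define good where "good = (\<lambda>k q. q k = 1 \<and> (\<forall>j>k. q j = 0) \<and>
    (\<forall>i. R k $ i = (\<Sum>j\<le>k. q j * R 0 $ (i + j))))"
  have "\<exists>q. good k q" for k
  proof (induction k rule: less_induct)
    case (less k)
    consider "k = 0" | "k = 1" | m where "k = m + 2"
      by (metis One_nat_def add_2_eq_Suc' not0_implies_Suc)
    then show ?case
    proof cases
      case 1
      then show ?thesis
        by (intro exI[of _ "\<lambda>j. if j = 0 then 1 else 0"]) (auto simp: good_def)
    next
      case 2
      then show ?thesis using R1'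
        by (intro exI[of _ "\<lambda>j. if j = 0 then - b 0 else if j = 1 then 1 else 0"])
          (auto simp: good_def)
    next
      case (3 m)
      obtain q r where q: "good (m + 1) q" and r: "good m r"
        using less.IH[of "m + 1"] less.IH[of m] 3 by auto
      define s where "s = (\<lambda>j. (case j of 0 \<Rightarrow> 0 | Suc j' \<Rightarrow> q j') - b (m + 1) * q j
        - l (m + 1) * r j)"
      have "R (m + 2) $ i = (\<Sum>j\<le>m + 2. s j * R 0 $ (i + j))" for i
      proof -
        have "(\<Sum>j\<le>m + 2. s j * R 0 $ (i + j)) =
            (\<Sum>j\<le>Suc (m + 1). (case j of 0 \<Rightarrow> 0 | Suc j' \<Rightarrow> q j') * R 0 $ (i + j))
            - b (m + 1) * (\<Sum>j\<le>m + 2. q j * R 0 $ (i + j))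
            - l (m + 1) * (\<Sum>j\<le>m + 2. r j * R 0 $ (i + j))"
          by (simp add: s_def left_diff_distrib sum_subtractf sum_distrib_left mult.assoc
              del: sum.atMost_Suc)
        also have "\<dots> = R (m + 1) $ Suc i - b (m + 1) * R (m + 1) $ i - l (m + 1) * R m $ i"
          unfolding shift using q r ext[of "m + 1" q "m + 2" i] ext[of m r "m + 2" i]
          by (simp add: good_def del: sum.atMost_Suc)
        finally show ?thesis
          by (simp only: R2')
      qed
      moreover have "s (m + 2) = 1" "\<forall>j>m + 2. s j = 0"
        using q r by (auto simp: s_def good_def split: nat.split)
      ultimately show ?thesis
        unfolding 3 good_def by blast
    qed
  qed
  then obtain p where p: "\<And>k. good k (p k)"
    by metis
  have p_diag: "p k k = 1" and p_above: "k < j \<Longrightarrow> p k j = 0"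
    and R: "R k $ i = (\<Sum>j\<le>k. p k j * R 0 $ (i + j))" for k i j
    using p[of k] unfolding good_def by blast+
  have "det (mat (Suc n) (Suc n) (\<lambda>(i, j). R 0 $ (i + j))) =
      (\<Prod>k\<le>n. \<Sum>j\<le>k. p k j * R 0 $ (k + j))"
    using p_diag p_above subdegree by (intro det_hankel_if_orthogonal) (simp_all flip: R)
  then show ?thesis
    by (simp only: R [symmetric])
qed

section \<open>The generating function as a quotient\<close>

text \<open>
  With \<open>T = 1 + z T\<^sup>3\<close> this is the series of \<open>T\<^sup>r / (T (3 - 2 T))\<close>. The index is shifted by two so that
  it is a natural number; the subtraction truncates only for \<open>j = 0\<close>, where the coefficient is \<open>1\<close>
  in any case.
\<close>
definition fuss :: "nat \<Rightarrow> real fps" where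
  "fuss r = Abs_fps (\<lambda>j. of_nat ((3 * j + r - 2) choose j))"

text \<open>This is Pascal's rule, and in terms of \<open>T\<close> the equation \<open>T = 1 + z T\<^sup>3\<close>.\<close>
lemma fuss_Suc: "fuss (Suc r) = fuss r + fps_X * fuss (r + 3)"
proof (rule fps_ext)
  fix j
  show "fuss (Suc r) $ j = (fuss r + fps_X * fuss (r + 3)) $ j"
  proof (cases j)
    case (Suc i)
    have "3 * Suc i + Suc r - 2 = Suc (3 * i + r + 1)" "3 * Suc i + r - 2 = 3 * i + r + 1"
        "3 * i + (r + 3) - 2 = 3 * i + r + 1"
      by simp_all
    then show ?thesis
      unfolding Suc fuss_def by (simp only: fps_add_nth fps_nth_Abs_fps fps_X_mult_nth) simp
  qed (simp add: fuss_def)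
qed

text \<open>
  The series \<open>1/T\<close>, introduced as the ratio of two consecutive series \<open>fuss r\<close>; the ratio does not
  depend on \<open>r\<close>, as the next lemma shows.
\<close>
definition fuss_ratio :: "real fps" where
  "fuss_ratio = fuss 0 * inverse (fuss 1)"

lemma fuss_step: "fuss r = fuss_ratio * fuss (Suc r)"
proof -
  define D where "D = (\<lambda>r. fuss r - fuss_ratio * fuss (Suc r))"
  have D0: "D 0 = 0"
  proof -
    have "inverse (fuss 1) * fuss 1 = 1"
      by (rule inverse_mult_eq_1) (simp add: fuss_def)
    then show ?thesis
      by (simp add: D_def fuss_ratio_def mult.assoc)
  qed
  have D_Suc: "D (Suc r) = D r + fps_X * D (r + 3)" for r
    using fuss_Suc[of r] fuss_Suc[of "Suc r"] by (simp add: D_def algebra_simps)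
  \<comment> \<open>The term \<open>D (r + 3)\<close> enters with a factor \<open>z\<close>, so only its lower coefficients are needed.\<close>
  have "D r $ k = 0" for r k
  proof (induction k arbitrary: r rule: less_induct)
    case (less k)
    show ?case
    proof (induction r)
      case (Suc r)
      show ?case
        using Suc less by (simp add: D_Suc)
    qed (simp add: D0)
  qed
  then have "D r = 0"
    by (simp add: fps_eq_iff)
  then show ?thesis
    by (simp add: D_def)
qed

text \<open>
  In terms of \<open>T\<close> this reads \<open>(3 - 2 T) / (3 - 2 T) = 1\<close>. Multiplied by \<open>fuss_ratio\<close>, it yields the
  coefficients of \<open>1/T\<close> from those of \<open>fuss 0\<close> and \<open>fuss 1\<close>.
\<close>
lemma fuss_unit: "3 * fuss 1 - 2 * fuss 2 = 1"
proof (rule fps_ext)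
  fix k
  show "(3 * fuss 1 - 2 * fuss 2) $ k = (1 :: real fps) $ k"
  proof (cases k)
    case (Suc i)
    have nth: "fuss 1 $ Suc i = real ((3 * i + 2) choose Suc i)"
        "fuss 2 $ Suc i = real ((3 * i + 3) choose Suc i)"
      by (simp_all add: fuss_def add.commute)
    have "(2 * i + 2) * ((3 * i + 3) choose Suc i) = (3 * i + 3) * ((3 * i + 2) choose Suc i)"
      using binomial_absorb_comp[of "3 * i + 3" "Suc i"] by (simp add: numeral_eq_Suc)
    then have "Suc i * (3 * ((3 * i + 2) choose Suc i)) = Suc i * (2 * ((3 * i + 3) choose Suc i))"
      by (simp add: algebra_simps)
    then have "3 * ((3 * i + 2) choose Suc i) = 2 * ((3 * i + 3) choose Suc i)"
      unfolding mult_cancel1 by blast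
    then have "real (3 * ((3 * i + 2) choose Suc i)) = real (2 * ((3 * i + 3) choose Suc i))"
      by (rule arg_cong)
    then have "3 * fuss 1 $ Suc i - 2 * fuss 2 $ Suc i = 0"
      unfolding nth of_nat_mult by (simp only: of_nat_numeral diff_self)
    then show ?thesis
      unfolding Suc numeral_fps_const by (simp only: fps_sub_nth fps_mult_left_const_nth) simp
  qed (simp add: fuss_def numeral_fps_const)
qed

lemma fuss_ratio_eq: "fuss_ratio = 3 * fuss 0 - 2 * fuss 1"
proof -
  have "fuss_ratio = fuss_ratio * (3 * fuss 1 - 2 * fuss 2)"
    by (simp only: fuss_unit mult_1_right)
  also have "\<dots> = 3 * (fuss_ratio * fuss (Suc 0)) - 2 * (fuss_ratio * fuss (Suc 1))"
    by (simp add: algebra_simps numeral_2_eq_2)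
  finally show ?thesis
    by (simp flip: fuss_step)
qed

lemma fuss_ratio_nth_0: "fuss_ratio $ 0 = 1"
  by (simp add: fuss_ratio_eq fuss_def numeral_fps_const)

lemma fuss_ratio_nth_Suc:
  "fuss_ratio $ Suc i = - fact (3 * i + 1) / (fact (Suc i) * fact (2 * i + 1))"
proof -
  have fact_odd: "(fact (2 * i + 1) :: real) = real (2 * i + 1) * fact (2 * i)"
    by (simp add: algebra_simps)
  have fact_3: "(fact (3 * i + 2) :: real) = fact (3 * i + 1) * real (3 * i + 2)"
    by (simp add: eval_nat_numeral algebra_simps)
  have 1: "fuss 0 $ Suc i = fact (3 * i + 1) * real (2 * i + 1) / (fact (Suc i) * fact (2 * i + 1))"
  proof -
    have cancel: "F / (D * E) = F * c / (D * (c * E))" if "c \<noteq> 0" for F D E c :: real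
      using that by (simp add: divide_simps)
    have "3 * i + 1 - Suc i = 2 * i"
      by simp
    then have "fuss 0 $ Suc i = fact (3 * i + 1) / (fact (Suc i) * fact (2 * i))"
      using binomial_fact[of "Suc i" "3 * i + 1", where 'a = real]
      by (simp add: fuss_def del: fact_Suc)
    also have "\<dots> = fact (3 * i + 1) * real (2 * i + 1) /
        (fact (Suc i) * (real (2 * i + 1) * fact (2 * i)))"
      by (rule cancel) linarith
    finally show ?thesis
      by (simp only: fact_odd)
  qed
  have 2: "fuss 1 $ Suc i = fact (3 * i + 1) * real (3 * i + 2) / (fact (Suc i) * fact (2 * i + 1))"
  proof -
    have "3 * i + 2 - Suc i = 2 * i + 1"
      by simp
    then have "real ((3 * i + 2) choose Suc i) =
        fact (3 * i + 2) / (fact (Suc i) * fact (2 * i + 1))"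
      using binomial_fact[of "Suc i" "3 * i + 2", where 'a = real] by (simp del: fact_Suc)
    moreover have "fuss 1 $ Suc i = real ((3 * i + 2) choose Suc i)"
      by (simp add: fuss_def)
    ultimately show ?thesis
      by (simp only: fact_3)
  qed
  have 3: "3 * (F * u / D) - 2 * (F * v / D) = - F / D" if "3 * u = 2 * v - 1" for F u v D :: real
  proof -
    have "3 * (F * u / D) - 2 * (F * v / D) = F * (3 * u - 2 * v) / D"
      by (simp only: times_divide_eq_right diff_divide_distrib right_diff_distrib mult.left_commute)
    then show ?thesis
      using that by simp
  qed
  show ?thesis
    unfolding fuss_ratio_eq numeral_fps_const fps_sub_nth fps_mult_left_const_nth 1 2
    by (rule 3) simp
qed

text \<open>
  The generating function of \<open>a\<^sub>k(x)\<close> is the case \<open>r = 1\<close>. The parameter \<open>r\<close> is what makes the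
  functional equations below close up.
\<close>
definition a_fps :: "real \<Rightarrow> nat \<Rightarrow> real fps" where
  "a_fps x r = Abs_fps (\<lambda>k. \<Sum>m\<le>k. of_nat ((3 * k + r - m) choose (k - m)) * x ^ m)"

text \<open>The term \<open>m = 0\<close> of each coefficient is split off.\<close>
lemma a_fps_rec: "a_fps x r = fuss (r + 2) + fps_const x * fps_X * a_fps x (r + 2)"
proof (rule fps_ext)
  fix k
  show "a_fps x r $ k = (fuss (r + 2) + fps_const x * fps_X * a_fps x (r + 2)) $ k"
  proof (cases k)
    case (Suc i)
    have "3 * Suc i + r - Suc m = 3 * i + (r + 2) - m" for m by simp
    then show ?thesis unfolding Suc a_fps_def
      by (simp add: mult.assoc sum.atMost_Suc_shift fuss_def sum_distrib_left mult_ac del: sum.atMost_Suc)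
  qed (simp add: a_fps_def fuss_def mult.assoc)
qed

lemma fps_zero_if_shift_rec:
  fixes D :: "nat \<Rightarrow> 'a :: comm_ring_1 fps"
  assumes "\<And>r. D r = fps_const x * fps_X * D (r + 2)"
  shows "D r = 0"
proof -
  have "D r $ k = 0" for r k
  proof (induction k arbitrary: r)
    case 0
    show ?case by (subst assms) (simp add: mult.assoc)
  next
    case (Suc k)
    show ?case by (subst assms) (simp add: mult.assoc Suc)
  qed
  then show ?thesis by (simp add: fps_eq_iff)
qed

lemma a_fps_step: "a_fps x r = fuss_ratio * a_fps x (Suc r)"
proof -
  define D where "D = (\<lambda>r. a_fps x r - fuss_ratio * a_fps x (Suc r))"
  have "D r = fps_const x * fps_X * D (r + 2)" for r
    using a_fps_rec[of x r] a_fps_rec[of x "Suc r"] fuss_step[of "r + 2"]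
    by (simp add: D_def algebra_simps)
  from fps_zero_if_shift_rec[of D x r, OF this] show ?thesis
    by (simp add: D_def)
qed

lemma a_fps_Suc: "a_fps x (Suc r) = a_fps x r + fps_X * a_fps x (r + 3)"
proof -
  define D where "D = (\<lambda>r. a_fps x (Suc r) - a_fps x r - fps_X * a_fps x (r + 3))"
  have "D r = fps_const x * fps_X * D (r + 2)" for r
    using a_fps_rec[of x r] a_fps_rec[of x "Suc r"] a_fps_rec[of x "r + 3"]
      fuss_Suc[of "r + 2"]
    by (simp add: D_def algebra_simps)
  from fps_zero_if_shift_rec[of D x r, OF this] show ?thesis
    by (simp add: D_def algebra_simps)
qed

lemma a_fps_1_eq: "(fps_const (1 - x) + fps_const x * fuss_ratio) * a_fps x 1 = fuss 3"
proof -
  have shift: "fps_X * a_fps x 3 = (1 - fuss_ratio) * a_fps x 1"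
    using a_fps_Suc[of x 0] a_fps_step[of x 0] by (simp add: algebra_simps)
  have const: "fps_const (1 - x) + fps_const x * fuss_ratio = 1 - fps_const x * (1 - fuss_ratio)"
    by (simp add: algebra_simps flip: fps_const_sub)
  have "a_fps x 1 = fuss 3 + fps_const x * (fps_X * a_fps x 3)"
    using a_fps_rec[of x 1] by (simp add: mult.assoc numeral_3_eq_3)
  then show ?thesis
    unfolding shift const by (simp only: left_diff_distrib mult.assoc mult_1_left diff_eq_eq)
qed

section \<open>The continued fraction remainders\<close>

text \<open>
  The normalization of the remainders. It is chosen such that the recurrence has the coefficient \<open>1\<close>
  at the term of highest index, which makes the associated orthogonal polynomials monic.
\<close>
definition kappa :: "nat \<Rightarrow> real" where
  "kappa n = fact (6 * n) * fact n / (fact (4 * n) * fact (3 * n))"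

text \<open>The ratio \<open>kappa (n + 1) / kappa n\<close>.\<close>
definition rho :: "nat \<Rightarrow> real" where
  "rho n = 3 * (6 * real n + 1) * (6 * real n + 5) / ((4 * real n + 1) * (4 * real n + 3))"

text \<open>
  The value of \<open>\<lambda>\<^sub>n \<kappa>\<^sub>n\<^sub>-\<^sub>1 / \<kappa>\<^sub>n\<close>, which is found by setting \<open>y = n - 1\<close> in \<open>rho_beta_mu_identity\<close> below.
\<close>
definition mu :: "nat \<Rightarrow> real" where
  "mu n = 3 * (9 * (real n)\<^sup>2 - 1) / (4 * (16 * (real n)\<^sup>2 - 1))"

text \<open>
  The coefficients of the recurrence. For \<open>n > 0\<close> the value of \<open>beta\<close> comes from comparing the terms
  in \<open>y\<^sup>2\<close> in \<open>rho_beta_mu_identity\<close>. For \<open>n = 0\<close> it is \<open>a\<^sub>1(3/2)\<close>. Only \<open>lambda n\<close> with \<open>n > 0\<close> matters.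
\<close>
definition beta :: "nat \<Rightarrow> real" where
  "beta n = (if n = 0 then 11 / 2 else (27 - rho n - 16 * mu n) / 4)"

definition lambda :: "nat \<Rightarrow> real" where
  "lambda n = mu n * rho (n - 1)"

lemma kappa_Suc: "kappa (Suc n) = rho n * kappa n"
proof -
  define x where "x = real n"
  have x: "x \<ge> 0"
    by (simp add: x_def)
  have 6: "(fact (6 * Suc n) :: real) = (6 * x + 6) * (6 * x + 5) * (6 * x + 4) * (6 * x + 3)
      * (6 * x + 2) * (6 * x + 1) * fact (6 * n)"
    by (simp add: x_def eval_nat_numeral) (simp add: algebra_simps)
  have 4: "(fact (4 * Suc n) :: real) = (4 * x + 4) * (4 * x + 3) * (4 * x + 2) * (4 * x + 1)
      * fact (4 * n)"
    by (simp add: x_def eval_nat_numeral) (simp add: algebra_simps)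
  have 3: "(fact (3 * Suc n) :: real) = (3 * x + 3) * (3 * x + 2) * (3 * x + 1) * fact (3 * n)"
    by (simp add: x_def eval_nat_numeral) (simp add: algebra_simps)
  have 1: "(fact (Suc n) :: real) = (x + 1) * fact n"
    by (simp add: x_def algebra_simps)
  show ?thesis
    unfolding kappa_def rho_def 6 4 3 1 x_def[symmetric] using x
    by (simp add: divide_simps) (simp add: algebra_simps)
qed

text \<open>
  The reciprocal of \<open>(i - n)!\<close>, read as \<open>0\<close> for \<open>i < n\<close>. With this convention the recurrence in \<open>n\<close>
  holds without case distinctions.
\<close>
definition inv_fact_diff :: "nat \<Rightarrow> nat \<Rightarrow> real" where
  "inv_fact_diff i n = (if n \<le> i then 1 / fact (i - n) else 0)"

lemma inv_fact_diff_Suc_Suc: "inv_fact_diff (Suc i) (Suc n) = inv_fact_diff i n"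
  by (simp add: inv_fact_diff_def)

lemma inv_fact_diff_Suc_right: "inv_fact_diff i (Suc n) = (real i - real n) * inv_fact_diff i n"
proof -
  consider "i < n" | "i = n" | d where "i = Suc (n + d)"
    by (metis less_iff_Suc_add linorder_neqE_nat)
  then show ?thesis
    by cases (auto simp: inv_fact_diff_def divide_simps)
qed

text \<open>
  The series \<open>h\<^sub>n z\<^sup>n F(n + 2/3, n + 4/3; 2n + 3/2; 27z/4)\<close>, with the Pochhammer symbols written as
  factorials and all factors that do not depend on \<open>i\<close> collected in \<open>kappa n\<close>.
\<close>
definition remainder :: "nat \<Rightarrow> real fps" where
  "remainder n = Abs_fps (\<lambda>i. kappa n * fact (3 * i + 1) * fact (n + i) * inv_fact_diff i n
     / (fact i * fact (2 * n + 2 * i + 1)))"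

text \<open>
  After division by the common factors, the contiguous relation between the coefficients of index
  \<open>i = y\<close> becomes this identity of quadratic polynomials in \<open>y\<close>.
\<close>
lemma rho_beta_mu_identity:
  fixes y :: real and n :: nat
  defines "x \<equiv> real n"
  assumes "n > 0"
  shows "rho n * ((y - x) * (y + 1 - x)) = 3 * (3 * y + 2) * (3 * y + 4)
    - 2 * beta n * ((y + 1 - x) * (2 * x + 2 * y + 3))
    - 4 * mu n * ((2 * x + 2 * y + 1) * (2 * x + 2 * y + 3))"
proof -
  have nz: "4 * x + 1 \<noteq> 0" "4 * x + 3 \<noteq> 0" "4 * x - 1 \<noteq> 0"
    using assms by auto
  have r: "rho n = 3 * (6 * x + 1) * (6 * x + 5) / ((4 * x + 1) * (4 * x + 3))"
    by (simp add: rho_def x_def)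
  have "16 * x\<^sup>2 - 1 = (4 * x - 1) * (4 * x + 1)"
    by (simp add: algebra_simps power2_eq_square)
  then have m: "mu n = 3 * (9 * x\<^sup>2 - 1) / (4 * ((4 * x - 1) * (4 * x + 1)))"
    by (simp add: mu_def x_def)
  have b: "beta n = (27 - rho n - 16 * mu n) / 4"
    using \<open>n > 0\<close> by (simp add: beta_def)
  show ?thesis
    unfolding b r m using nz by (simp add: divide_simps) (simp add: algebra_simps power2_eq_square)
qed

lemma remainder_rec:
  "fps_X * remainder (n + 2) = (1 - fps_const (beta (n + 1)) * fps_X) * remainder (n + 1)
     - fps_const (lambda (n + 1)) * fps_X * remainder n"
proof (rule fps_ext)
  fix k
  show "(fps_X * remainder (n + 2)) $ k = ((1 - fps_const (beta (n + 1)) * fps_X) * remainder (n + 1)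
     - fps_const (lambda (n + 1)) * fps_X * remainder n) $ k"
  proof (cases k)
    case 0
    then show ?thesis
      by (simp add: remainder_def inv_fact_diff_def mult.assoc algebra_simps)
  next
    case (Suc i)
    define x y where "x = real n" and "y = real i"
    define G where "G = inv_fact_diff (Suc i) (Suc n)"
    \<comment> \<open>All four terms of the relation are \<open>(n + i + 2) (n + i + 1) C\<close> times a polynomial in \<open>i\<close>.\<close>
    define C where "C = kappa (n + 1) * fact (3 * i + 1) * fact (n + i) * G
      / (fact i * fact (2 * n + 2 * i + 5))"
    have k2: "kappa (n + 2) = rho (n + 1) * kappa (n + 1)"
      using kappa_Suc[of "n + 1"] by simp
    have k1: "lambda (n + 1) * kappa n = mu (n + 1) * kappa (n + 1)"
      using kappa_Suc[of n] by (simp add: lambda_def)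
    have f1: "fact (2 * n + 2 * i + 5) = (2 * x + 2 * y + 5) * (2 * x + 2 * y + 4) *
        (fact (2 * n + 2 * i + 3) :: real)"
      "fact (2 * n + 2 * i + 3) = (2 * x + 2 * y + 3) * (2 * x + 2 * y + 2) *
        (fact (2 * n + 2 * i + 1) :: real)"
      by (simp_all add: eval_nat_numeral x_def y_def algebra_simps)
    have f2: "fact (n + i + 2) = (x + y + 2) * (x + y + 1) * (fact (n + i) :: real)"
      "fact (n + i + 1) = (x + y + 1) * (fact (n + i) :: real)"
      by (simp_all add: eval_nat_numeral x_def y_def algebra_simps)
    have f3: "fact (3 * Suc i + 1) = (3 * y + 4) * (3 * y + 3) * (3 * y + 2) * (fact (3 * i + 1) :: real)"
      by (simp add: eval_nat_numeral y_def algebra_simps)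
    have f4: "fact (Suc i) = (y + 1) * (fact i :: real)"
      by (simp add: y_def algebra_simps)
    have pos: "x \<ge> 0" "y \<ge> 0"
      by (simp_all add: x_def y_def)
    have g0: "inv_fact_diff i n = G"
      by (simp add: G_def inv_fact_diff_Suc_Suc)
    have g1: "inv_fact_diff i (n + 1) = (y - x) * G"
      using inv_fact_diff_Suc_right[of i n] g0 by (simp add: x_def y_def)
    have g2: "inv_fact_diff i (n + 2) = (y - x - 1) * (y - x) * G"
      unfolding add_2_eq_Suc' inv_fact_diff_Suc_right x_def y_def g0 by simp
    have e2: "remainder (n + 2) $ i =
       (x + y + 2) * (x + y + 1) * C * (rho (n + 1) * ((y - x - 1) * (y - x)))"
    proof -
      have "2 * (n + 2) + 2 * i + 1 = 2 * n + 2 * i + 5" "n + 2 + i = n + i + 2" by simp_all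
      then show ?thesis
        unfolding remainder_def C_def by (simp only: fps_nth_Abs_fps k2 f2 g2) simp
    qed
    have e1: "remainder (n + 1) $ i =
       (x + y + 2) * (x + y + 1) * C * (2 * (2 * x + 2 * y + 5) * (y - x))"
    proof -
      have "2 * (n + 1) + 2 * i + 1 = 2 * n + 2 * i + 3" "n + 1 + i = n + i + 1" by simp_all
      then show ?thesis using pos
        unfolding remainder_def C_def
        by (simp only: fps_nth_Abs_fps f2 g1 f1(1))
          (simp add: divide_simps, simp add: algebra_simps)
    qed
    have e0: "lambda (n + 1) * remainder n $ i =
       (x + y + 2) * (x + y + 1) * C * (mu (n + 1) * (4 * (2 * x + 2 * y + 5) * (2 * x + 2 * y + 3)))"
    proof -
      have shift: "fact (n + i) * G / (fact i * fact (2 * n + 2 * i + 1)) =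
          4 * (2 * x + 2 * y + 5) * (2 * x + 2 * y + 3) * (x + y + 2) * (x + y + 1) *
          (fact (n + i) * G / (fact i * fact (2 * n + 2 * i + 5)))"
        unfolding f1 using pos by (simp add: divide_simps) (simp add: algebra_simps)
      have "lambda (n + 1) * remainder n $ i = (lambda (n + 1) * kappa n) * fact (3 * i + 1) *
        (fact (n + i) * G / (fact i * fact (2 * n + 2 * i + 1)))"
        by (simp add: remainder_def g0)
      then show ?thesis
        unfolding k1 shift C_def by (simp only: times_divide_eq_right times_divide_eq_left mult_ac)
    qed
    have e3: "remainder (n + 1) $ Suc i =
       (x + y + 2) * (x + y + 1) * C * (3 * (3 * y + 4) * (3 * y + 2))"
    proof -
      have "2 * (n + 1) + 2 * Suc i + 1 = 2 * n + 2 * i + 5" "n + 1 + Suc i = n + i + 2" by simp_all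
      moreover have "inv_fact_diff (Suc i) (n + 1) = G"
        by (simp add: G_def)
      ultimately show ?thesis
        using pos unfolding remainder_def C_def
        by (simp only: fps_nth_Abs_fps f2 f3 f4)
          (simp del: fact_Suc add: divide_simps, simp add: algebra_simps)
    qed
    have distrib: "K * (P - c * Q - M) = K * P - c * (K * Q) - K * M" for K P c Q M :: real
      by (simp only: right_diff_distrib mult.left_commute)
    have "rho (n + 1) * ((y - x - 1) * (y - x)) = 3 * (3 * y + 4) * (3 * y + 2)
        - beta (n + 1) * (2 * (2 * x + 2 * y + 5) * (y - x))
        - mu (n + 1) * (4 * (2 * x + 2 * y + 5) * (2 * x + 2 * y + 3))"
      using rho_beta_mu_identity[of "n + 1" y] by (simp add: x_def algebra_simps)
    then have "remainder (n + 2) $ i = remainder (n + 1) $ Suc i - beta (n + 1) * remainder (n + 1) $ i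
       - lambda (n + 1) * remainder n $ i"
      unfolding e0 e1 e2 e3 by (simp only: distrib)
    then show ?thesis
      unfolding Suc by (simp add: algebra_simps)
  qed
qed

text \<open>
  The series \<open>F(-1/3, 1/3; 1/2; 27z/4)\<close>; it is the factor \<open>(1 - x) + x / T\<close> at \<open>x = 3/2\<close>.
\<close>
definition denom :: "real fps" where
  "denom = fps_const (- 1 / 2) + fps_const (3 / 2) * fuss_ratio"

lemma denom_nth_0: "denom $ 0 = 1"
  by (simp add: denom_def fuss_ratio_nth_0)

lemma denom_nth_Suc:
  "denom $ Suc i = - (3 / 2) * (fact (3 * i + 1) / (fact (Suc i) * fact (2 * i + 1)))"
  by (simp add: denom_def fuss_ratio_nth_Suc del: fact_Suc)

lemma remainder_nth_less: "i < n \<Longrightarrow> remainder n $ i = 0"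
  by (simp add: remainder_def inv_fact_diff_def)

lemma remainder_nth_self:
  "remainder n $ n = fact (6 * n) * fact (2 * n) * real (3 * n + 1) / (fact (4 * n) * fact (4 * n + 1))"
proof -
  have fact_3: "(fact (3 * n + 1) :: real) = real (3 * n + 1) * fact (3 * n)"
    by (simp add: algebra_simps)
  have double: "2 * n + 2 * n + 1 = 4 * n + 1" "n + n = 2 * n"
    by simp_all
  show ?thesis
    unfolding remainder_def fps_nth_Abs_fps kappa_def inv_fact_diff_def fact_3 double
    by (simp del: fact_Suc)
qed

lemma remainder_0: "remainder 0 = fuss 3"
proof (rule fps_ext)
  fix k :: nat
  have "3 * k + 1 - k = 2 * k + 1"
    by simp
  then have "real ((3 * k + 1) choose k) = fact (3 * k + 1) / (fact k * fact (2 * k + 1))"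
    using binomial_fact[of k "3 * k + 1", where 'a = real] by (simp del: fact_Suc)
  then show "remainder 0 $ k = fuss 3 $ k"
    by (simp add: remainder_def fuss_def kappa_def inv_fact_diff_def del: fact_Suc)
qed

text \<open>
  The initial contiguous relation is not the case \<open>n = 0\<close> of the general one: \<open>denom\<close> takes the place
  of the preceding remainder.
\<close>
lemma remainder_1:
  "fps_X * remainder 1 = (1 - fps_const (beta 0) * fps_X) * remainder 0 - denom"
proof (rule fps_ext)
  fix k
  show "(fps_X * remainder 1) $ k =
    ((1 - fps_const (beta 0) * fps_X) * remainder 0 - denom) $ k"
  proof (cases k)
    case 0
    then show ?thesis
      by (simp add: remainder_def inv_fact_diff_def kappa_def denom_nth_0 mult.assoc algebra_simps)
  next
    case (Suc i)
    define y where "y = real i"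
    define F f g :: real where "F = fact (3 * i + 1)" and "f = fact i" and "g = fact (2 * i + 1)"
    have pos: "y \<ge> 0" "f \<noteq> 0" "g \<noteq> 0"
      by (simp_all add: y_def f_def g_def)
    have F': "fact (3 * Suc i + 1) = (3 * y + 4) * (3 * y + 3) * (3 * y + 2) * F"
      by (simp add: eval_nat_numeral y_def F_def algebra_simps)
    have f': "fact (Suc i) = (y + 1) * f"
      by (simp add: y_def f_def algebra_simps)
    have g': "fact (2 * i + 3) = (2 * y + 3) * (2 * y + 2) * g"
      by (simp add: eval_nat_numeral y_def g_def algebra_simps)
    have k0: "kappa 0 = 1"
      by (simp add: kappa_def)
    have k1: "kappa (Suc 0) = 5"
      using kappa_Suc[of 0] by (simp add: k0 rho_def)
    have d: "denom $ Suc i = - (3 / 2) * (F / ((y + 1) * f * g))"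
      unfolding denom_nth_Suc f' F_def g_def ..
    have r0: "remainder 0 $ i = F / (f * g)"
      using pos by (simp add: remainder_def k0 inv_fact_diff_def F_def f_def g_def del: fact_Suc)
    have r0': "remainder 0 $ Suc i =
        (3 * y + 4) * (3 * y + 3) * (3 * y + 2) * F / ((y + 1) * f * ((2 * y + 3) * (2 * y + 2) * g))"
    proof -
      have "2 * 0 + 2 * Suc i + 1 = 2 * i + 3"
        by simp
      then show ?thesis
        unfolding remainder_def fps_nth_Abs_fps k0 inv_fact_diff_def
        by (simp only: F' f' g' add_0 diff_zero) (use pos in simp)
    qed
    have r1: "remainder (Suc 0) $ i = 5 * F * (y + 1) * y / (f * ((2 * y + 3) * (2 * y + 2) * g))"
    proof -
      have "2 * Suc 0 + 2 * i + 1 = 2 * i + 3" "Suc 0 + i = Suc i"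
        by simp_all
      moreover have "inv_fact_diff i (Suc 0) = y / f"
        by (simp add: inv_fact_diff_Suc_right y_def f_def) (simp add: inv_fact_diff_def)
      ultimately show ?thesis
        unfolding remainder_def fps_nth_Abs_fps k1
        by (simp only: f' g') (use pos in \<open>simp add: F_def f_def del: fact_Suc\<close>)
    qed
    have "remainder (Suc 0) $ i = remainder 0 $ Suc i - 11 / 2 * remainder 0 $ i - denom $ Suc i"
      unfolding d r0 r0' r1 using pos
      by (simp add: divide_simps) (simp add: algebra_simps)
    then show ?thesis
      unfolding Suc by (simp add: beta_def algebra_simps)
  qed
qed

section \<open>The evaluation\<close>

theorem corollary2:
  fixes n :: nat
  shows "hankel_det n (3 / 2 :: real) =
    (\<Prod>i=1..n. (fact (2 * i - 1) * fact (6 * i) * (3 * real i + 1)) /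
                (2 * fact (4 * i - 1) * fact (4 * i + 1)))"
proof -
  define R where "R k = remainder k * inverse denom" for k
  have unit: "denom * inverse denom = 1"
    by (rule inverse_mult_eq_1') (simp add: denom_nth_0)
  have "denom * a_fps (3 / 2) 1 = fuss 3"
    using a_fps_1_eq[of "3 / 2"] by (simp add: denom_def)
  then have "R 0 = (denom * inverse denom) * a_fps (3 / 2) 1"
    by (simp add: R_def remainder_0 mult_ac)
  then have R0: "R 0 $ k = a_poly k (3 / 2)" for k
    by (simp add: unit a_fps_def a_poly_def atMost_atLeast0)
  have R1: "fps_X * R 1 = (1 - fps_const (beta 0) * fps_X) * R 0 - 1"
  proof -
    have "fps_X * R 1 = (fps_X * remainder 1) * inverse denom"
      by (simp add: R_def mult.assoc)
    also have "\<dots> = (1 - fps_const (beta 0) * fps_X) * R 0 - denom * inverse denom"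
      unfolding remainder_1 by (simp add: R_def left_diff_distrib mult.assoc)
    finally show ?thesis
      by (simp only: unit)
  qed
  have R2: "fps_X * R (k + 2) =
      (1 - fps_const (beta (k + 1)) * fps_X) * R (k + 1) - fps_const (lambda (k + 1)) * fps_X * R k"
    for k
  proof -
    have "fps_X * R (k + 2) = (fps_X * remainder (k + 2)) * inverse denom"
      by (simp add: R_def mult.assoc)
    then show ?thesis
      unfolding remainder_rec by (simp add: R_def left_diff_distrib mult.assoc)
  qed
  have R_less: "R k $ i = 0" if "i < k" for k i
    using that by (simp add: R_def fps_mult_nth remainder_nth_less)
  have R_self: "R k $ k = remainder k $ k" for k
  proof -
    have "R k $ k = (\<Sum>i\<in>{k}. remainder k $ i * inverse denom $ (k - i))"
      unfolding R_def fps_mult_nth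
      by (rule sum.mono_neutral_right) (auto simp: remainder_nth_less)
    then show ?thesis
      by (simp add: denom_nth_0)
  qed
  have factor: "remainder i $ i = (fact (2 * i - 1) * fact (6 * i) * (3 * real i + 1)) /
      (2 * fact (4 * i - 1) * fact (4 * i + 1))" if "i \<ge> 1" for i
  proof -
    have "(fact (2 * i) :: real) = 2 * real i * fact (2 * i - 1)"
        "(fact (4 * i) :: real) = 4 * real i * fact (4 * i - 1)"
      using that by (simp_all add: fact_reduce)
    then show ?thesis
      unfolding remainder_nth_self using that by (simp del: fact_Suc add: divide_simps)
  qed
  have "hankel_det n (3 / 2 :: real) = det (mat (Suc n) (Suc n) (\<lambda>(i, j). R 0 $ (i + j)))"
    by (simp add: hankel_det_def R0)
  also have "\<dots> = (\<Prod>k\<le>n. R k $ k)"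
    by (rule det_hankel_three_term[OF R1 R2 R_less])
  also have "\<dots> = remainder 0 $ 0 * (\<Prod>k=1..n. remainder k $ k)"
    unfolding R_self
    by (simp add: atMost_atLeast0 prod.atLeast_Suc_atMost)
  also have "remainder 0 $ 0 = 1"
    by (simp add: remainder_nth_self)
  finally show ?thesis
    using factor by simp
qed

end
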